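(* Let $H$ be an arbitrary finite simple graph (not necessarily Sidorenko, not necessarily bipartite) and let $k\ge 2$ be an integer. Then $H\square C_{2k}$ is a non-trivial square. Moreover, the following construction gives a square root of $H\square C_{2k}$ for every such $H$ and $k$: take the induced subgraph of $H\square C_{2k}$ on the vertices $(v,i)$ with $v\in V(H)$, $1\le i\le k+1$, give pairwise distinct labels to all vertices $(v,1)$ and $(v,k+1)$, and leave all vertices $(v,i)$ with $2\le i\le k$ unlabeled.
   Context: All graphs are finite, simple, without loops, with at least one vertex. A partially labeled graph is a graph in which some (possibly none, possibly all) vertices carry labels from $\mathbb{N}=\{1,2,3,\dots\}$, no two vertices having the same label and no vertex having more than one label. The product $F_1F_2$ of two partially labeled graphs is obtained by taking their disjoint union, gluing together vertices with the same label, and keeping only one copy of any doubled edge; $F^2=FF$. For a partially labeled graph $F$, $[[F]]$ is the unlabeled graph obtained by removing all labels. Equality of unlabeled graphs means isomorphism. An unlabeled graph $H$ is a trivial square if whenever $H=[[F^2]]$ for a partially labeled graph $F$, then $F$ is a fully labeled copy of $H$. Otherwise $H$ is a non-trivial square, and any $F$ with $H=[[F^2]]$ that is not a fully labeled copy of $H$ is called a square root of $H$. $H\square C_{2k}$ is the Cartesian product of $H$ with the cycle of length $2k$: its vertex set is $\{(v,i): v\in V(H),\ 1\le i\le 2k\}$, and $(u,i)$, $(v,j)$ are adjacent iff either $i=j$ and $uv\in E(H)$, or $u=v$ and $i-j\equiv \pm1 \pmod{2k}$. *)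

theory Defs
  imports "Graph_Theory.Graph_Theory" "HOL-Number_Theory.Cong"
begin

text \<open>
  A finite simple graph is a finite, symmetric, loopless arc relation on a vertex set, that is
  a \<^locale>\<open>pair_graph\<close>. An undirected edge \<open>uv\<close> is the pair of arcs \<open>(u, v)\<close>, \<open>(v, u)\<close>.
\<close>

definition simple_graph :: "'a pair_pre_digraph \<Rightarrow> bool" where
  "simple_graph G \<longleftrightarrow> pair_graph G \<and> pverts G \<noteq> {}"

definition graph_iso :: "'a pair_pre_digraph \<Rightarrow> 'b pair_pre_digraph \<Rightarrow> bool" where
  "graph_iso G H \<longleftrightarrow> digraph_iso (with_proj G) (with_proj H)"

definition pair_induce :: "'a pair_pre_digraph \<Rightarrow> 'a set \<Rightarrow> 'a pair_pre_digraph" where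
  "pair_induce G S = \<lparr>pverts = S, parcs = {(u, v) \<in> parcs G. u \<in> S \<and> v \<in> S}\<rparr>"

lemma with_proj_pair_induce: "with_proj (pair_induce G S) = with_proj G \<restriction> S"
  by (auto simp: with_proj_def pair_induce_def induce_subgraph_def)

definition cart_prod :: "'a pair_pre_digraph \<Rightarrow> 'b pair_pre_digraph \<Rightarrow> ('a \<times> 'b) pair_pre_digraph" where
  "cart_prod G H =
    \<lparr>pverts = pverts G \<times> pverts H,
     parcs = {((u, i), (v, j)) | u i v j.
       (i = j \<and> i \<in> pverts H \<and> (u, v) \<in> parcs G) \<or> (u = v \<and> u \<in> pverts G \<and> (i, j) \<in> parcs H)}\<rparr>"

text \<open>The cycle \<open>C\<^sub>n\<close> on the vertices \<open>1, \<dots>, n\<close>; it is a simple graph only for \<open>n \<ge> 3\<close>.\<close>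

definition cycle_graph :: "nat \<Rightarrow> nat pair_pre_digraph" where
  "cycle_graph n =
    \<lparr>pverts = {1..n},
     parcs = {(i, j). i \<in> {1..n} \<and> j \<in> {1..n} \<and>
       ([int i - int j = 1] (mod int n) \<or> [int i - int j = - 1] (mod int n))}\<rparr>"

text \<open>
  In a partially labeled graph, \<open>pl_label F v = None\<close> means that \<open>v\<close> is unlabeled. Labels are
  positive integers. The unlabeled graph \<open>[[F]]\<close> is \<open>pl_graph F\<close>.
\<close>

record 'a pl_graph =
  pl_graph :: "'a pair_pre_digraph"
  pl_label :: "'a \<rightharpoonup> nat"

definition distinct_labeling :: "('a \<rightharpoonup> nat) \<Rightarrow> bool" where
  "distinct_labeling L \<longleftrightarrow> inj_on L (dom L) \<and> ran L \<subseteq> {1..}"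

definition partially_labeled_graph :: "'a pl_graph \<Rightarrow> bool" where
  "partially_labeled_graph F \<longleftrightarrow>
    simple_graph (pl_graph F) \<and> dom (pl_label F) \<subseteq> pverts (pl_graph F) \<and>
    distinct_labeling (pl_label F)"

definition disjoint_union :: "'a pair_pre_digraph \<Rightarrow> 'b pair_pre_digraph \<Rightarrow> ('a + 'b) pair_pre_digraph" where
  "disjoint_union G H =
    \<lparr>pverts = pverts G <+> pverts H,
     parcs = map_prod Inl Inl ` parcs G \<union> map_prod Inr Inr ` parcs H\<rparr>"

definition glue_rel :: "'a pair_pre_digraph \<Rightarrow> ('a \<rightharpoonup> nat) \<Rightarrow> 'a rel" where
  "glue_rel G L = {(x, y). x \<in> pverts G \<and> y \<in> pverts G \<and>
     (x = y \<or> (\<exists>l. L x = Some l \<and> L y = Some l))}"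

text \<open>
  The vertices of the product are the classes of vertices of the disjoint union under gluing.
  Since the arcs form a set, arcs that become parallel are identified. All members of a class have
  the same label (or are unlabeled), so \<^const>\<open>the_elem\<close> is applied to a singleton.
\<close>

definition pl_prod :: "'a pl_graph \<Rightarrow> 'b pl_graph \<Rightarrow> ('a + 'b) set pl_graph" where
  "pl_prod F1 F2 =
    (let G = disjoint_union (pl_graph F1) (pl_graph F2);
         L = case_sum (pl_label F1) (pl_label F2);
         R = glue_rel G L;
         V = pverts G // R
     in \<lparr>pl_graph = \<lparr>pverts = V, parcs = (\<lambda>(x, y). (R `` {x}, R `` {y})) ` parcs G\<rparr>,
         pl_label = (\<lambda>X. if X \<in> V then the_elem (L ` X) else None)\<rparr>)"

abbreviation pl_square :: "'a pl_graph \<Rightarrow> ('a + 'a) set pl_graph" where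
  "pl_square F \<equiv> pl_prod F F"

definition fully_labeled_copy :: "'a pl_graph \<Rightarrow> 'b pair_pre_digraph \<Rightarrow> bool" where
  "fully_labeled_copy F H \<longleftrightarrow>
    dom (pl_label F) = pverts (pl_graph F) \<and> graph_iso (pl_graph F) H"

text \<open>
  A definition cannot quantify over types, so the roots \<open>F\<close> range over partially labeled graphs
  with vertices in \<^typ>\<open>nat\<close>. Every finite graph has a copy of this form.
\<close>

definition trivial_square :: "'b pair_pre_digraph \<Rightarrow> bool" where
  "trivial_square H \<longleftrightarrow>
    (\<forall>F :: nat pl_graph. partially_labeled_graph F \<and> graph_iso H (pl_graph (pl_square F))
       \<longrightarrow> fully_labeled_copy F H)"

definition nontrivial_square :: "'b pair_pre_digraph \<Rightarrow> bool" where
  "nontrivial_square H \<longleftrightarrow> \<not> trivial_square H"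

definition square_root :: "'a pl_graph \<Rightarrow> 'b pair_pre_digraph \<Rightarrow> bool" where
  "square_root F H \<longleftrightarrow>
    partially_labeled_graph F \<and> graph_iso H (pl_graph (pl_square F)) \<and> \<not> fully_labeled_copy F H"

definition half_cylinder ::
  "'a pair_pre_digraph \<Rightarrow> nat \<Rightarrow> ('a \<times> nat \<rightharpoonup> nat) \<Rightarrow> ('a \<times> nat) pl_graph" where
  "half_cylinder H k L =
    \<lparr>pl_graph = pair_induce (cart_prod H (cycle_graph (2 * k))) (pverts H \<times> {1..k + 1}),
     pl_label = L\<rparr>"

text \<open>Labelings as in the construction always exist.\<close>

lemma ex_distinct_labeling:
  assumes "finite A"
  shows "\<exists>L. distinct_labeling L \<and> dom L = A"
proof -
  obtain f :: "'a \<Rightarrow> nat" where f: "inj_on f A"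
    using finite_imp_inj_to_nat_seg[OF assms] by (elim exE conjE)
  define L where "L = (\<lambda>x. if x \<in> A then Some (Suc (f x)) else None)"
  have "dom L = A" by (simp add: L_def dom_def)
  moreover have "inj_on L A" using f by (simp add: L_def inj_on_def)
  moreover have "ran L \<subseteq> {1..}" by (fastforce simp: L_def ran_def split: if_splits)
  ultimately have "distinct_labeling L \<and> dom L = A" by (simp add: distinct_labeling_def)
  then show ?thesis by (rule exI[of _ L])
qed

end

theory Submission
  imports Defs
begin

text \<open>
  The cycle \<open>C\<close> on \<open>1, \<dots>, 2k\<close> has a reflection that fixes exactly the two antipodal vertices
  \<open>1\<close> and \<open>k + 1\<close>; it exchanges the two paths into which they cut \<open>C\<close>. Applied to the
  second coordinate, it is an automorphism of \<open>H \<box> C\<close> that exchanges two half cylinders. Each of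
  them is an induced subgraph, together they cover all vertices and edges, and they share exactly
  the vertices \<open>(v, 1)\<close> and \<open>(v, k + 1)\<close>. Gluing two disjoint copies of the half cylinder along
  these vertices therefore gives back \<open>H \<box> C\<close>. The vertex \<open>(v, 2)\<close> has no label because
  \<open>k \<ge> 2\<close>, so the half cylinder is not a fully labeled copy.

  The argument separates into a statement about squares and one about cylinders. By
  \<open>square_if_two_copies\<close>, a graph is the square of \<open>F\<close> as soon as two embedded copies of \<open>F\<close> cover
  it and meet only in corresponding labeled vertices. By \<open>two_copies_half_cylinder\<close>, the half
  cylinder and its reflection are such copies. Triviality of a square is a condition on roots whose
  vertices are natural numbers; \<open>nontrivial_square_if_two_copies\<close> renames the vertices of the root
  accordingly.
\<close>

section \<open>Simple graphs and isomorphisms in terms of vertex and arc sets\<close>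

lemma simple_graph_iff:
  "simple_graph G \<longleftrightarrow> finite (pverts G) \<and> pverts G \<noteq> {} \<and> parcs G \<subseteq> pverts G \<times> pverts G \<and>
     sym (parcs G) \<and> irrefl (parcs G)"
  (is "_ = ?R")
proof
  assume "simple_graph G"
  then interpret pair_graph G by (simp add: simple_graph_def)
  show ?R
    using \<open>simple_graph G\<close> pair_finite_verts pair_sym_arcs
    by (auto simp: simple_graph_def symmetric_def irrefl_def dest: in_arcsD1 in_arcsD2 pair_no_loops)
next
  assume R: ?R
  then have "finite (parcs G)" by (meson finite_SigmaI finite_subset)
  with R have "pair_graph G"
    by unfold_locales (auto simp: symmetric_def irrefl_def)
  with R show "simple_graph G" by (simp add: simple_graph_def)
qed

definition graph_image :: "('a \<Rightarrow> 'b) \<Rightarrow> 'a pair_pre_digraph \<Rightarrow> 'b pair_pre_digraph" where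
  "graph_image f G = \<lparr>pverts = f ` pverts G, parcs = map_prod f f ` parcs G\<rparr>"

lemma graph_image_simps [simp]:
  "pverts (graph_image f G) = f ` pverts G"
  "parcs (graph_image f G) = map_prod f f ` parcs G"
  by (simp_all add: graph_image_def)

lemma graph_iso_graph_image:
  assumes "parcs G \<subseteq> pverts G \<times> pverts G" and "inj_on f (pverts G)"
  shows "graph_iso G (graph_image f G)"
proof -
  let ?h = "\<lparr>iso_verts = f, iso_arcs = map_prod f f, iso_head = snd, iso_tail = fst\<rparr>"
  have "pair_wf_digraph G"
    using assms(1) by unfold_locales auto
  moreover have "inj_on (map_prod f f) (parcs G)"
    using map_prod_inj_on[OF assms(2) assms(2)] assms(1) by (rule inj_on_subset)
  ultimately have "pre_digraph.digraph_isomorphism (with_proj G) ?h"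
    using assms(2) by (simp add: pre_digraph.digraph_isomorphism_def wf_digraph_wp_iff)
  moreover have "with_proj (graph_image f G) = app_iso ?h (with_proj G)"
    by (simp add: app_iso_def with_proj_def)
  ultimately show ?thesis
    unfolding graph_iso_def digraph_iso_def by blast
qed

lemma simple_graph_graph_image:
  assumes "simple_graph G" and "inj_on f (pverts G)"
  shows "simple_graph (graph_image f G)"
proof -
  have G: "finite (pverts G)" "pverts G \<noteq> {}" "parcs G \<subseteq> pverts G \<times> pverts G"
      "sym (parcs G)" "irrefl (parcs G)"
    using assms(1) by (simp_all add: simple_graph_iff)
  have "sym (map_prod f f ` parcs G)"
    using G(4) by (force simp: sym_def)
  moreover have "irrefl (map_prod f f ` parcs G)"
    using G(3,5) assms(2) by (auto simp: irrefl_def dest: inj_onD)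
  ultimately show ?thesis
    using G by (auto simp: simple_graph_iff)
qed

section \<open>Recognising a square\<close>

text \<open>
  The maps \<open>\<alpha>\<close> and \<open>\<beta>\<close> play the part of the two inclusions of \<open>F\<close> into its square: gluing
  identifies a vertex of the first copy with one of the second exactly if both come from the
  same labeled vertex of \<open>F\<close>. Taking images of arcs permits an edge between labeled vertices to be
  covered twice.
\<close>

definition two_copies ::
  "'v pl_graph \<Rightarrow> ('v \<Rightarrow> 'b) \<Rightarrow> ('v \<Rightarrow> 'b) \<Rightarrow> 'b pair_pre_digraph \<Rightarrow> bool" where
  "two_copies F \<alpha> \<beta> G \<longleftrightarrow>
     (let V = pverts (pl_graph F); A = parcs (pl_graph F) in
       inj_on \<alpha> V \<and> inj_on \<beta> V \<and>
       (\<forall>v\<in>V. \<forall>w\<in>V. \<alpha> v = \<beta> w \<longleftrightarrow> v = w \<and> v \<in> dom (pl_label F)) \<and>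
       pverts G = \<alpha> ` V \<union> \<beta> ` V \<and>
       parcs G = map_prod \<alpha> \<alpha> ` A \<union> map_prod \<beta> \<beta> ` A)"

text \<open>
  The two maps combine to a map from the disjoint union onto \<open>G\<close>, and the conditions on their
  values say that its fibers are the gluing classes. Hence sending a vertex of \<open>G\<close> to its fiber
  identifies \<open>G\<close> with the quotient.
\<close>

lemma square_if_two_copies:
  assumes F: "partially_labeled_graph F" and copies: "two_copies F \<alpha> \<beta> G"
  shows "graph_iso G (pl_graph (pl_square F))"
proof -
  define V where "V = pverts (pl_graph F)"
  define L where "L = pl_label F"
  define D where "D = disjoint_union (pl_graph F) (pl_graph F)"
  define R where "R = glue_rel D (case_sum L L)"
  define \<phi> where "\<phi> = case_sum \<alpha> \<beta>"
  define \<psi> where "\<psi> = (\<lambda>z. {y \<in> pverts D. \<phi> y = z})"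
  have \<alpha>: "\<alpha> v = \<alpha> w \<longleftrightarrow> v = w" and \<beta>: "\<beta> v = \<beta> w \<longleftrightarrow> v = w"
    and \<alpha>\<beta>: "\<alpha> v = \<beta> w \<longleftrightarrow> v = w \<and> v \<in> dom L" if "v \<in> V" "w \<in> V" for v w
    using copies that by (auto simp: two_copies_def Let_def V_def L_def inj_on_eq_iff)
  have \<beta>\<alpha>: "\<beta> v = \<alpha> w \<longleftrightarrow> v = w \<and> v \<in> dom L" if "v \<in> V" "w \<in> V" for v w
    using \<alpha>\<beta>[of w v] that by metis
  have lab: "(\<exists>l. L v = Some l \<and> L w = Some l) \<longleftrightarrow> v = w \<and> v \<in> dom L" for v w
    using F unfolding partially_labeled_graph_def distinct_labeling_def L_def
    by (metis domD domI inj_onD)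
  have A: "parcs (pl_graph F) \<subseteq> V \<times> V"
    using F by (auto simp: partially_labeled_graph_def simple_graph_iff V_def)
  have VD: "pverts D = V <+> V"
    by (simp add: D_def disjoint_union_def V_def)
  have AD: "parcs D = map_prod Inl Inl ` parcs (pl_graph F) \<union> map_prod Inr Inr ` parcs (pl_graph F)"
    by (simp add: D_def disjoint_union_def)
  have VG: "pverts G = \<phi> ` pverts D"
    using copies by (simp add: two_copies_def Let_def VD V_def \<phi>_def Plus_def image_Un image_image)
  have AG: "parcs G = map_prod \<phi> \<phi> ` parcs D"
    using copies
    by (simp add: two_copies_def Let_def AD \<phi>_def image_Un image_image map_prod_def split_def)
  \<comment> \<open>The gluing classes are the fibers of \<open>\<phi>\<close>.\<close>
  have "(x, y) \<in> R \<longleftrightarrow> \<phi> x = \<phi> y" if "x \<in> pverts D" "y \<in> pverts D" for x y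
  proof -
    have "(x, y) \<in> R \<longleftrightarrow> x = y \<or> (\<exists>l. case_sum L L x = Some l \<and> case_sum L L y = Some l)"
      using that by (simp add: R_def glue_rel_def)
    then show ?thesis
      using that unfolding VD by (elim PlusE) (auto simp: \<phi>_def lab \<alpha> \<beta> \<alpha>\<beta> \<beta>\<alpha>)
  qed
  then have cls: "R `` {x} = \<psi> (\<phi> x)" if "x \<in> pverts D" for x
    using that by (auto simp: \<psi>_def R_def glue_rel_def)
  have "pl_graph (pl_square F) = graph_image \<psi> G"
  proof -
    have "pverts D // R = \<psi> ` pverts G"
      by (auto simp: quotient_def VG cls)
    moreover have "(\<lambda>(x, y). (R `` {x}, R `` {y})) ` parcs D = map_prod \<psi> \<psi> ` parcs G"
    proof -
      have "parcs D \<subseteq> pverts D \<times> pverts D"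
        using A by (auto simp: AD VD)
      then show ?thesis
        unfolding AG image_image by (intro image_cong) (auto simp: cls)
    qed
    ultimately show ?thesis
      by (simp add: pl_prod_def Let_def graph_image_def D_def R_def L_def)
  qed
  moreover have "inj_on \<psi> (pverts G)"
    by (rule inj_onI) (auto simp: VG \<psi>_def)
  moreover have "parcs G \<subseteq> pverts G \<times> pverts G"
    using A by (auto simp: AG VG AD VD)
  ultimately show ?thesis
    by (simp add: graph_iso_graph_image)
qed

lemma square_root_if_two_copies:
  assumes "partially_labeled_graph F" and "two_copies F \<alpha> \<beta> G"
    and "dom (pl_label F) \<noteq> pverts (pl_graph F)"
  shows "square_root F G"
  using assms square_if_two_copies by (auto simp: square_root_def fully_labeled_copy_def)

text \<open>
  A root of arbitrary vertex type is carried to one on the natural numbers by an injection \<open>f\<close>; if \<open>g\<close>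
  undoes \<open>f\<close>, then \<open>\<alpha> \<circ> g\<close> and \<open>\<beta> \<circ> g\<close> embed the renamed root with the same images as before.
\<close>

lemma nontrivial_square_if_two_copies:
  fixes F :: "'v pl_graph"
  assumes F: "partially_labeled_graph F" and copies: "two_copies F \<alpha> \<beta> G"
    and unlabeled: "dom (pl_label F) \<noteq> pverts (pl_graph F)"
  shows "nontrivial_square G"
proof -
  define V where "V = pverts (pl_graph F)"
  define L where "L = pl_label F"
  have V: "finite V" "parcs (pl_graph F) \<subseteq> V \<times> V" "dom L \<subseteq> V"
    using F by (auto simp: partially_labeled_graph_def simple_graph_iff V_def L_def)
  obtain f :: "'v \<Rightarrow> nat" where f: "inj_on f V"
    using finite_imp_inj_to_nat_seg[OF V(1)] by auto
  define g where "g = the_inv_into V f"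
  have gf: "g (f v) = v" if "v \<in> V" for v
    using f that by (simp add: g_def the_inv_into_f_f)
  define F' where "F' = \<lparr>pl_graph = graph_image f (pl_graph F),
      pl_label = (\<lambda>n. if n \<in> f ` V then L (g n) else None)\<rparr>"
  have dom': "dom (pl_label F') = f ` dom L"
  proof (intro equalityI subsetI)
    fix n assume "n \<in> dom (pl_label F')"
    then have "n \<in> f ` V" "g n \<in> dom L"
      by (auto simp: F'_def split: if_splits)
    then show "n \<in> f ` dom L"
      by (metis gf imageE imageI)
  next
    fix n assume "n \<in> f ` dom L"
    then show "n \<in> dom (pl_label F')"
      using V(3) by (auto simp: F'_def gf subset_iff)
  qed
  have "distinct_labeling (pl_label F')"
  proof -
    have L: "inj_on L (dom L)" "ran L \<subseteq> {1..}"
      using F by (simp_all add: partially_labeled_graph_def distinct_labeling_def L_def)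
    have "inj_on (pl_label F') (f ` dom L)"
      using L(1) V(3) by (auto simp: inj_on_def F'_def gf subset_iff)
    moreover have "ran (pl_label F') \<subseteq> ran L"
      by (auto simp: F'_def ran_def split: if_splits)
    ultimately show ?thesis
      using L(2) by (auto simp: distinct_labeling_def dom')
  qed
  moreover have "simple_graph (pl_graph F')"
    using F f by (simp add: F'_def V_def partially_labeled_graph_def simple_graph_graph_image)
  moreover have "dom (pl_label F') \<subseteq> pverts (pl_graph F')"
    using V(3) unfolding dom' by (auto simp: F'_def V_def)
  ultimately have F': "partially_labeled_graph F'"
    by (simp add: partially_labeled_graph_def)
  have "two_copies F' (\<alpha> \<circ> g) (\<beta> \<circ> g) G"
  proof -
    have images: "(h \<circ> g) ` f ` V = h ` V"
        "map_prod (h \<circ> g) (h \<circ> g) ` map_prod f f ` parcs (pl_graph F)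
          = map_prod h h ` parcs (pl_graph F)" for h :: "'v \<Rightarrow> 'b"
      using V(2) gf by (auto simp: image_image intro!: image_cong)
    have vertices: "pverts (pl_graph F') = f ` V"
      "parcs (pl_graph F') = map_prod f f ` parcs (pl_graph F)"
      by (simp_all add: F'_def V_def)
    have dom_iff: "f v \<in> f ` dom L \<longleftrightarrow> v \<in> dom L" if "v \<in> V" for v
      using f V(3) that by (meson inj_on_image_mem_iff)
    show ?thesis
      using copies unfolding two_copies_def Let_def vertices dom' images V_def[symmetric] L_def[symmetric]
      by (simp add: inj_on_def gf dom_iff)
        (use f in \<open>auto simp: inj_on_eq_iff\<close>)
  qed
  moreover have "dom (pl_label F') \<noteq> pverts (pl_graph F')"
  proof -
    have "f ` dom L \<noteq> f ` V"
      using unlabeled inj_on_image_eq_iff[OF f V(3) order_refl] by (simp add: V_def L_def)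
    then show ?thesis
      unfolding dom' by (simp add: F'_def V_def)
  qed
  ultimately have "square_root F' G"
    using F' square_root_if_two_copies by blast
  then show ?thesis
    by (auto simp: nontrivial_square_def trivial_square_def square_root_def)
qed

section \<open>The even cycle as two paths\<close>

text \<open>
  This replaces congruences by linear conditions. The difference of two vertices lies strictly
  between \<open>-n\<close> and \<open>n\<close>, so it is congruent to \<open>1\<close> only if it equals \<open>1\<close> or \<open>1 - n\<close>.
\<close>

lemma cycle_graph_arc_iff:
  "(i, j) \<in> parcs (cycle_graph n) \<longleftrightarrow> i \<in> {1..n} \<and> j \<in> {1..n} \<and>
    (j = Suc i \<or> i = Suc j \<or> i = 1 \<and> j = n \<or> i = n \<and> j = 1)"
proof -
  have "[int i - int j = 1] (mod int n) \<longleftrightarrow> i = Suc j \<or> i = 1 \<and> j = n"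
    if ij: "i \<in> {1..n}" "j \<in> {1..n}" for i j
  proof
    assume "[int i - int j = 1] (mod int n)"
    then obtain q where q: "int i - int j - 1 = int n * q"
      by (auto simp: cong_iff_dvd_diff dvd_def)
    have "- int n \<le> int n * q" "int n * q < int n"
      using ij by (auto simp flip: q)
    then have "int n * (- 1) \<le> int n * q" "int n * q < int n * 1" by auto
    moreover have "0 < int n"
      using ij by simp
    ultimately have "-1 \<le> q" "q < 1"
      by (simp_all only: mult_le_cancel_left_pos mult_less_cancel_left_pos)
    then have "q = -1 \<or> q = 0" by auto
    then show "i = Suc j \<or> i = 1 \<and> j = n"
      using q ij by auto
  next
    assume "i = Suc j \<or> i = 1 \<and> j = n"
    then show "[int i - int j = 1] (mod int n)"
      by (auto simp: cong_iff_dvd_diff)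
  qed
  note step = this
  have "[int i - int j = - 1] (mod int n) \<longleftrightarrow> [int j - int i = 1] (mod int n)"
    by (metis cong_minus_minus_iff minus_diff_eq)
  then show ?thesis
    using step[of i j] step[of j i] by (auto simp: cycle_graph_def)
qed

text \<open>
  This is \<open>i \<mapsto> 2 - i\<close> modulo \<open>n\<close>, with representatives in \<open>1, \<dots>, n\<close>: it fixes \<open>1\<close> and, for
  \<open>n = 2k\<close>, also \<open>k + 1\<close>.
\<close>

definition reflect :: "nat \<Rightarrow> nat \<Rightarrow> nat" where
  "reflect n i = (if i = 1 then 1 else n + 2 - i)"

lemma reflect_arc:
  assumes "(i, j) \<in> parcs (cycle_graph n)"
  shows "(reflect n i, reflect n j) \<in> parcs (cycle_graph n)"
proof -
  have ij: "1 \<le> i" "i \<le> n" "1 \<le> j" "j \<le> n"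
    and adj: "j = i + 1 \<or> i = j + 1 \<or> i = 1 \<and> j = n \<or> i = n \<and> j = 1"
    using assms by (simp_all add: cycle_graph_arc_iff)
  show ?thesis
    unfolding cycle_graph_arc_iff atLeastAtMost_iff reflect_def
    using adj ij by (elim disjE conjE; cases "i = 1"; cases "j = 1"; simp; linarith?)
qed

text \<open>
  An edge cannot cross between the interiors of the two paths, because the fixed vertices \<open>1\<close> and
  \<open>k + 1\<close> separate them.
\<close>

lemma cycle_arc_in_half:
  assumes "(i, j) \<in> parcs (cycle_graph (2 * k))"
  shows "i \<in> {1..k + 1} \<and> j \<in> {1..k + 1} \<or>
    reflect (2 * k) i \<in> {1..k + 1} \<and> reflect (2 * k) j \<in> {1..k + 1}"
proof -
  have ij: "1 \<le> i" "i \<le> 2 * k" "1 \<le> j" "j \<le> 2 * k"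
    and adj: "j = i + 1 \<or> i = j + 1 \<or> i = 1 \<and> j = 2 * k \<or> i = 2 * k \<and> j = 1"
    using assms by (simp_all add: cycle_graph_arc_iff)
  show ?thesis
    unfolding atLeastAtMost_iff reflect_def
    using adj ij by (elim disjE conjE; cases "i = 1"; cases "j = 1"; simp; linarith?)
qed

section \<open>The half cylinder and its mirror image\<close>

lemma simple_graph_cart_prod:
  assumes "simple_graph G" and "simple_graph H"
  shows "simple_graph (cart_prod G H)"
  using assms by (auto simp: simple_graph_iff cart_prod_def sym_def irrefl_def)

lemma simple_graph_cycle_graph:
  assumes "n \<ge> 3"
  shows "simple_graph (cycle_graph n)"
  using assms
  by (auto simp: simple_graph_iff cycle_graph_arc_iff sym_def irrefl_def) (auto simp: cycle_graph_def)

lemma simple_graph_pair_induce: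
  assumes "simple_graph G" and "S \<subseteq> pverts G" and "S \<noteq> {}"
  shows "simple_graph (pair_induce G S)"
  using assms by (auto simp: simple_graph_iff pair_induce_def sym_def irrefl_def intro: finite_subset)

lemma partially_labeled_half_cylinder:
  assumes "simple_graph H" and "k \<ge> 2"
    and "distinct_labeling L" and "dom L = pverts H \<times> {1, k + 1}"
  shows "partially_labeled_graph (half_cylinder H k L)"
proof -
  let ?G = "cart_prod H (cycle_graph (2 * k))"
  have "simple_graph ?G"
    using assms(1,2) by (intro simple_graph_cart_prod simple_graph_cycle_graph) auto
  moreover have "pverts H \<times> {1..k + 1} \<subseteq> pverts ?G"
    using assms(2) by (auto simp: cart_prod_def cycle_graph_def)
  moreover have "pverts H \<times> {1..k + 1} \<noteq> {}"
    using assms(1) by (auto simp: simple_graph_iff)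
  ultimately have "simple_graph (pair_induce ?G (pverts H \<times> {1..k + 1}))"
    by (rule simple_graph_pair_induce)
  moreover have "pverts H \<times> {1, k + 1} \<subseteq> pverts H \<times> {1..k + 1}"
    by auto
  ultimately show ?thesis
    using assms(3,4) by (simp add: partially_labeled_graph_def half_cylinder_def pair_induce_def)
qed

text \<open>
  The copies cover the edges for a different reason in each direction: an edge of a copy
  of \<open>H\<close> lies in the half that contains the copy, and an edge along the cycle is placed by \<open>cycle_arc_in_half\<close>. They meet
  only in fixed points of the reflection because it sends \<open>2, \<dots>, k\<close> to \<open>k + 2, \<dots>, 2k\<close>.
\<close>

lemma two_copies_half_cylinder:
  assumes "simple_graph H" and "k \<ge> 2" and "dom L = pverts H \<times> {1, k + 1}"
  shows "two_copies (half_cylinder H k L) id (apsnd (reflect (2 * k)))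
    (cart_prod H (cycle_graph (2 * k)))"
proof -
  let ?G = "cart_prod H (cycle_graph (2 * k))"
  let ?r = "reflect (2 * k)"
  define W where "W = pverts H \<times> {1..k + 1}"
  define A where "A = {(x, y) \<in> parcs ?G. x \<in> W \<and> y \<in> W}"
  have F: "pverts (pl_graph (half_cylinder H k L)) = W"
      "parcs (pl_graph (half_cylinder H k L)) = A"
      "pl_label (half_cylinder H k L) = L"
    by (simp_all add: half_cylinder_def pair_induce_def W_def A_def)
  have arc: "((u, i), (v, j)) \<in> parcs ?G \<longleftrightarrow>
      i = j \<and> i \<in> {1..2 * k} \<and> (u, v) \<in> parcs H \<or>
      u = v \<and> u \<in> pverts H \<and> (i, j) \<in> parcs (cycle_graph (2 * k))" for u i v j
    by (auto simp: cart_prod_def cycle_graph_def)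
  have H: "parcs H \<subseteq> pverts H \<times> pverts H"
    using assms(1) by (simp add: simple_graph_iff)
  have cyc: "parcs (cycle_graph (2 * k)) \<subseteq> {1..2 * k} \<times> {1..2 * k}"
    by (auto simp: cycle_graph_def)
  have invol: "?r (?r i) = i" and range: "?r i \<in> {1..2 * k}" if "i \<in> {1..2 * k}" for i
    using that by (auto simp: reflect_def)
  \<comment> \<open>The reflection is an automorphism of the whole cylinder, so the second copy is a subgraph.\<close>
  have refl_arc: "(apsnd ?r x, apsnd ?r y) \<in> parcs ?G"
    if "(x, y) \<in> parcs ?G" for x y
    using that cyc range reflect_arc
    by (cases x; cases y) (auto simp: arc simp del: atLeastAtMost_iff)
  have inj: "inj_on (apsnd ?r) W"
    using assms(2) by (auto simp: inj_on_def W_def reflect_def split: if_splits)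
  have meet: "v = apsnd ?r w \<longleftrightarrow> v = w \<and> v \<in> dom L" if "v \<in> W" "w \<in> W" for v w
    using that assms(2,3) by (cases v; cases w) (auto simp: W_def reflect_def split: if_splits)
  have vertices: "pverts ?G = W \<union> apsnd ?r ` W"
  proof (intro equalityI subsetI)
    fix x assume "x \<in> pverts ?G"
    then obtain v i where x: "x = (v, i)" "v \<in> pverts H" "i \<in> {1..2 * k}"
      by (auto simp: cart_prod_def cycle_graph_def)
    then have "i \<in> {1..k + 1} \<or> ?r i \<in> {1..k + 1}"
      by (auto simp: reflect_def)
    then have "(v, i) \<in> W \<or> (v, ?r i) \<in> W"
      using x(2) by (simp add: W_def)
    moreover have "apsnd ?r (v, ?r i) = x"
      using x invol by simp
    ultimately show "x \<in> W \<union> apsnd ?r ` W"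
      using x(1) by (metis UnI1 UnI2 imageI)
  next
    fix x assume "x \<in> W \<union> apsnd ?r ` W"
    then show "x \<in> pverts ?G"
      using assms(2) by (auto simp: W_def cart_prod_def cycle_graph_def reflect_def)
  qed
  have arcs: "parcs ?G = A \<union> map_prod (apsnd ?r) (apsnd ?r) ` A"
  proof (intro equalityI subsetI)
    fix a assume a: "a \<in> parcs ?G"
    obtain u i v j where uv: "a = ((u, i), (v, j))"
      by (metis prod.exhaust)
    have ends: "u \<in> pverts H" "v \<in> pverts H" "i \<in> {1..2 * k}" "j \<in> {1..2 * k}"
      using a H cyc by (auto simp: uv arc)
    have "i \<in> {1..k + 1} \<and> j \<in> {1..k + 1} \<or> ?r i \<in> {1..k + 1} \<and> ?r j \<in> {1..k + 1}"
    proof (cases "i = j")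
      case True
      then show ?thesis using ends by (auto simp: reflect_def)
    next
      case False
      then show ?thesis using a cycle_arc_in_half[of i j k] by (auto simp: uv arc)
    qed
    then show "a \<in> A \<union> map_prod (apsnd ?r) (apsnd ?r) ` A"
    proof
      assume "i \<in> {1..k + 1} \<and> j \<in> {1..k + 1}"
      then show ?thesis using a ends by (simp add: A_def W_def uv)
    next
      assume "?r i \<in> {1..k + 1} \<and> ?r j \<in> {1..k + 1}"
      then have "((u, ?r i), (v, ?r j)) \<in> A"
        using a ends refl_arc[of "(u, i)" "(v, j)"] by (simp add: A_def W_def uv)
      moreover have "a = map_prod (apsnd ?r) (apsnd ?r) ((u, ?r i), (v, ?r j))"
        using ends invol by (simp add: uv)
      ultimately show ?thesis by blast
    qed
  next
    fix a assume "a \<in> A \<union> map_prod (apsnd ?r) (apsnd ?r) ` A"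
    then show "a \<in> parcs ?G"
      using refl_arc by (auto simp: A_def)
  qed
  show ?thesis
    unfolding two_copies_def Let_def F prod.map_id0 image_id id_apply
    using inj_on_id2 inj meet vertices arcs by (intro conjI ballI)
qed

theorem theorem2p9:
  fixes H :: "'a pair_pre_digraph" and k :: nat
  assumes "simple_graph H" and "k \<ge> 2"
  shows "nontrivial_square (cart_prod H (cycle_graph (2 * k))) \<and>
    (\<forall>L. distinct_labeling L \<and> dom L = pverts H \<times> {1, k + 1} \<longrightarrow>
       square_root (half_cylinder H k L) (cart_prod H (cycle_graph (2 * k))))"
proof -
  have unlabeled: "dom (pl_label (half_cylinder H k L)) \<noteq> pverts (pl_graph (half_cylinder H k L))"
    if "dom L = pverts H \<times> {1, k + 1}" for L
  proof -
    obtain v where "v \<in> pverts H"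
      using assms(1) by (auto simp: simple_graph_iff)
    then have "(v, 2) \<in> pverts H \<times> {1..k + 1} - pverts H \<times> {1, k + 1}"
      using assms(2) by auto
    then have "pverts H \<times> {1, k + 1} \<noteq> pverts H \<times> {1..k + 1}"
      by blast
    then show ?thesis
      using that by (simp add: half_cylinder_def pair_induce_def del: One_nat_def)
  qed
  have "finite (pverts H \<times> {1, k + 1})"
    using assms(1) by (simp add: simple_graph_iff)
  from ex_distinct_labeling[OF this] obtain L
    where L: "distinct_labeling L" "dom L = pverts H \<times> {1, k + 1}" by blast
  have "nontrivial_square (cart_prod H (cycle_graph (2 * k)))"
    using partially_labeled_half_cylinder[OF assms L]
      two_copies_half_cylinder[OF assms L(2)] unlabeled[OF L(2)]
    by (rule nontrivial_square_if_two_copies)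
  moreover have "square_root (half_cylinder H k L) (cart_prod H (cycle_graph (2 * k)))"
    if "distinct_labeling L" "dom L = pverts H \<times> {1, k + 1}" for L
    using partially_labeled_half_cylinder[OF assms that]
      two_copies_half_cylinder[OF assms that(2)] unlabeled[OF that(2)]
    by (rule square_root_if_two_copies)
  ultimately show ?thesis by blast
qed

end
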